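(* Let $p,q\in\mathbb N$ with $p>q\ge1$, let $\varphi$ be the morphism on $\{0,1\}^*$ with $\varphi(0)=0^p1$, $\varphi(1)=0^q1$, and let $\mathbf u$ be its fixed point starting with $0$ (a binary non-simple Parry sequence). For each $n\in\mathbb N$, $n\ge1$, the prefix $\varphi^n(0)$ of $\mathbf u$ has the attractor $$\Gamma_n=\Bigl\{\sum_{j=0}^{n-1}|\varphi^j(0)|-1,\ \ |\varphi^n(0)|-\sum_{j=1}^{n-1}|\varphi^j(1)|-1\Bigr\}.$$
   Context: $\varphi^0$ is the identity. A (string) attractor of a finite word $w=w_0\cdots w_{N-1}$ is a set $\Gamma\subseteq\{0,\dots,N-1\}$ such that every non-empty factor of $w$ has an occurrence $w_i\cdots w_{j-1}$ with $\{i,\dots,j-1\}\cap\Gamma\ne\emptyset$; positions are indexed from $0$. An empty sum equals $0$. *)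

theory Defs
  imports "HOL-Library.Z2" "HOL-Library.Sublist" "HOL-Library.Stream"
begin

text \<open>Finite words over the alphabet \<open>{0, 1}\<close> are lists over \<^typ>\<open>bit\<close>, infinite words are streams
  over \<^typ>\<open>bit\<close>; only the two letters of \<^typ>\<open>bit\<close> are used, not its arithmetic.\<close>

definition \<phi>_letter :: "nat \<Rightarrow> nat \<Rightarrow> bit \<Rightarrow> bit list" where
  "\<phi>_letter p q a = replicate (if a = 0 then p else q) 0 @ [1]"

definition \<phi> :: "nat \<Rightarrow> nat \<Rightarrow> bit list \<Rightarrow> bit list" where
  "\<phi> p q w = concat (map (\<phi>_letter p q) w)"

text \<open>The extension of the morphism to infinite words, \<open>u\<^sub>0 u\<^sub>1 \<dots> \<mapsto> \<phi>(u\<^sub>0) \<phi>(u\<^sub>1) \<dots>\<close>. The images of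
  letters are non-empty, so \<^const>\<open>flat\<close> is indeed infinite concatenation here.\<close>

definition \<phi>_inf :: "nat \<Rightarrow> nat \<Rightarrow> bit stream \<Rightarrow> bit stream" where
  "\<phi>_inf p q u = flat (smap (\<phi>_letter p q) u)"

text \<open>Here \<^term>\<open>sublist f w\<close> says that \<open>f\<close> is a factor (contiguous subword) of \<open>w\<close>.\<close>

definition occurs_at :: "'a list \<Rightarrow> 'a list \<Rightarrow> nat \<Rightarrow> bool" where
  "occurs_at f w i \<longleftrightarrow> i + length f \<le> length w \<and> take (length f) (drop i w) = f"

definition is_attractor :: "'a list \<Rightarrow> nat set \<Rightarrow> bool" where
  "is_attractor w \<Gamma> \<longleftrightarrow>
     \<Gamma> \<subseteq> {0..<length w} \<and>
     (\<forall>f. f \<noteq> [] \<and> sublist f w \<longrightarrow>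
        (\<exists>i. occurs_at f w i \<and> {i..<i + length f} \<inter> \<Gamma> \<noteq> {}))"

definition \<Gamma>\<^sub>n :: "nat \<Rightarrow> nat \<Rightarrow> nat \<Rightarrow> nat set" where
  "\<Gamma>\<^sub>n p q n =
     {(\<Sum>j\<in>{0..<n}. length ((\<phi> p q ^^ j) [0])) - 1,
      length ((\<phi> p q ^^ n) [0]) - (\<Sum>j\<in>{1..<n}. length ((\<phi> p q ^^ j) [1])) - 1}"

text \<open>The subtractions on \<^typ>\<open>nat\<close> in this definition never truncate:\<close>

lemma \<phi>_append: "\<phi> p q (v @ w) = \<phi> p q v @ \<phi> p q w"
  by (simp add: \<phi>_def)

lemma \<phi>_pow_append: "(\<phi> p q ^^ n) (v @ w) = (\<phi> p q ^^ n) v @ (\<phi> p q ^^ n) w"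
  by (induction n) (simp_all add: \<phi>_append)

lemma \<phi>_pow_Suc_0:
  assumes "p > 0"
  shows "(\<phi> p q ^^ Suc n) [0] =
    (\<phi> p q ^^ n) [0] @ (\<phi> p q ^^ n) (replicate (p - 1) 0) @ (\<phi> p q ^^ n) [1]"
proof -
  have "\<phi> p q [0] = [0] @ replicate (p - 1) 0 @ [1]"
    using assms by (cases p) (auto simp: \<phi>_def \<phi>_letter_def)
  then have "(\<phi> p q ^^ Suc n) [0] = (\<phi> p q ^^ n) ([0] @ replicate (p - 1) 0 @ [1])"
    by (simp add: funpow_Suc_right del: funpow.simps)
  then show ?thesis
    by (simp only: \<phi>_pow_append)
qed

lemma \<Gamma>\<^sub>n_no_truncation:
  assumes "p > 0" "n \<ge> 1"
  shows "1 \<le> (\<Sum>j\<in>{0..<n}. length ((\<phi> p q ^^ j) [0]))"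
    and "(\<Sum>j\<in>{1..<n}. length ((\<phi> p q ^^ j) [1])) + 1 \<le> length ((\<phi> p q ^^ n) [0])"
proof -
  have "(\<Sum>j\<in>{0..<1}. length ((\<phi> p q ^^ j) [0])) \<le> (\<Sum>j\<in>{0..<n}. length ((\<phi> p q ^^ j) [0]))"
    using assms(2) by (intro sum_mono2) auto
  then show "1 \<le> (\<Sum>j\<in>{0..<n}. length ((\<phi> p q ^^ j) [0]))"
    by simp
  show "(\<Sum>j\<in>{1..<n}. length ((\<phi> p q ^^ j) [1])) + 1 \<le> length ((\<phi> p q ^^ n) [0])"
    using assms(2)
  proof (induction n rule: dec_induct)
    case base
    show ?case using assms(1) by (simp add: \<phi>_def \<phi>_letter_def)
  next
    case (step n)
    then show ?case
      unfolding \<phi>_pow_Suc_0[OF assms(1)] by simp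
  qed
qed

text \<open>The fixed point of the morphism starting with \<open>0\<close> exists and is unique:\<close>

lemma \<phi>_inf_shift: "\<phi>_inf p q (w @- u) = \<phi> p q w @- \<phi>_inf p q u"
proof (induction w)
  case (Cons a w)
  have "\<phi>_letter p q a \<noteq> []" by (simp add: \<phi>_letter_def)
  with Cons show ?case by (simp add: \<phi>_inf_def \<phi>_def flat_unfold)
qed (simp add: \<phi>_def)

lemma length_\<phi>_pow_0:
  assumes "p > 0"
  shows "n < length ((\<phi> p q ^^ n) [0])"
proof (induction n)
  case (Suc n)
  have "(\<phi> p q ^^ n) [1] \<noteq> []"
  proof (induction n)
    case (Suc n)
    then show ?case by (cases "(\<phi> p q ^^ n) [1]") (auto simp: \<phi>_def \<phi>_letter_def)
  qed simp
  with Suc show ?case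
    unfolding \<phi>_pow_Suc_0[OF assms] length_append by (simp flip: length_greater_0_conv)
qed simp

lemma stream_eqI_\<phi>_pow:
  assumes "p > 0"
    and "\<And>n. \<exists>s. u = (\<phi> p q ^^ n) [0] @- s" "\<And>n. \<exists>s. v = (\<phi> p q ^^ n) [0] @- s"
  shows "u = v"
proof -
  have "u !! n = v !! n" for n
  proof -
    obtain s t where "u = (\<phi> p q ^^ n) [0] @- s" "v = (\<phi> p q ^^ n) [0] @- t"
      using assms(2,3) by blast
    then show ?thesis
      using length_\<phi>_pow_0[OF assms(1), of n q] by (simp add: shift_snth_less)
  qed
  then show ?thesis
    by (metis ext smap_alt stream.map_id0 id_apply)
qed

lemma \<phi>_inf_fixed_point_ex1:
  assumes "p > 0"
  shows "\<exists>!u. \<phi>_inf p q u = u \<and> shd u = 0"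
proof -
  let ?W = "\<lambda>n. (\<phi> p q ^^ n) [0]"
  have step: "prefix (?W n) (?W (Suc n))" for n
    unfolding \<phi>_pow_Suc_0[OF assms] by simp
  have mono: "prefix (?W m) (?W n)" if "m \<le> n" for m n
    using that
  proof (induction n rule: dec_induct)
    case (step n)
    then show ?case using \<open>prefix (?W n) (?W (Suc n))\<close> prefix_order.trans by blast
  qed simp
  have nth: "?W m ! i = ?W n ! i" if "i < length (?W m)" "i < length (?W n)" for i m n
  proof (cases "m \<le> n")
    case True
    then show ?thesis using mono[OF True] that by (auto simp: prefix_def nth_append)
  next
    case False
    then have "n \<le> m" by simp
    then show ?thesis using mono[OF \<open>n \<le> m\<close>] that by (auto simp: prefix_def nth_append)
  qed
  define u where "u = smap (\<lambda>i. ?W i ! i) nats"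
  have u_W: "\<exists>s. u = ?W n @- s" for n
  proof -
    have "stake (length (?W n)) u = ?W n"
    proof (rule nth_equalityI)
      fix i assume "i < length (stake (length (?W n)) u)"
      then show "stake (length (?W n)) u ! i = ?W n ! i"
        using nth[of i i n] length_\<phi>_pow_0[OF assms, of i q]
        by (simp add: u_def)
    qed simp
    then show ?thesis by (metis stake_sdrop)
  qed
  have "shd u = 0"
    using u_W[of 0] by auto
  have fix_W: "\<exists>s. \<phi>_inf p q u = ?W n @- s" for n
  proof -
    obtain s where s: "u = ?W n @- s" using u_W by blast
    have "\<phi>_inf p q u = ?W (Suc n) @- \<phi>_inf p q s"
      by (subst s) (simp add: \<phi>_inf_shift)
    moreover obtain t where "?W (Suc n) = ?W n @ t"
      using step[of n] by (auto simp: prefix_def)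
    ultimately show ?thesis by (metis shift_append)
  qed
  have fixed: "\<phi>_inf p q u = u"
    using stream_eqI_\<phi>_pow[OF assms] fix_W u_W by blast
  have any_W: "\<exists>s. v = ?W n @- s" if "\<phi>_inf p q v = v" "shd v = 0" for v n
  proof (induction n)
    case 0
    then show ?case using that(2) by (cases v) auto
  next
    case (Suc n)
    then obtain s where "v = ?W n @- s" by blast
    then have "\<phi>_inf p q v = ?W (Suc n) @- \<phi>_inf p q s"
      by (simp add: \<phi>_inf_shift)
    then show ?case using that(1) by metis
  qed
  show ?thesis
    using fixed \<open>shd u = 0\<close> any_W u_W stream_eqI_\<phi>_pow[OF assms] by blast
qed

end

theory Submission
  imports Defs
begin

text \<open>
  Put \<open>W\<^sub>n = \<phi>\<^sup>n(0)\<close> and \<open>T\<^sub>n = \<phi>\<^sup>n(1)\<close>, so that \<open>W\<^sub>n\<^sub>+\<^sub>1 = W\<^sub>n\<^sup>p T\<^sub>n\<close> and \<open>T\<^sub>n\<^sub>+\<^sub>1 = W\<^sub>n\<^sup>q T\<^sub>n\<close>.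
  The two positions of \<open>\<Gamma>\<^sub>n\<^sub>+\<^sub>1\<close> are those of \<open>\<Gamma>\<^sub>n\<close>, the first one moved to the second and the
  second one to the last of the \<open>p\<close> copies of \<open>W\<^sub>n\<close> in \<open>W\<^sub>n\<^sub>+\<^sub>1\<close>; hence a factor of \<open>W\<^sub>n\<close> is taken care
  of by induction. For any other factor either a shift by a multiple of the period \<open>|W\<^sub>n|\<close>
  moves it onto \<open>\<Gamma>\<^sub>n\<^sub>+\<^sub>1\<close>, or it avoids both positions modulo the period, or it lies in the tail of
  \<open>W\<^sub>n\<^sub>+\<^sub>1\<close> behind \<open>\<Gamma>\<^sub>n\<^sub>+\<^sub>1\<close>. In the last two cases it turns out to be a factor of \<open>W\<^sub>n\<close> after all.
\<close>

section \<open>Occurrences\<close>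

lemma occurs_at_iff_nth:
  "occurs_at f w i \<longleftrightarrow> i + length f \<le> length w \<and> (\<forall>k<length f. w ! (i + k) = f ! k)"
  by (auto simp: occurs_at_def list_eq_iff_nth_eq)

lemma sublist_iff_occurs_at: "sublist f w \<longleftrightarrow> (\<exists>i. occurs_at f w i)"
proof
  assume "sublist f w"
  then obtain x y where "w = x @ f @ y" by (auto simp: sublist_def)
  then have "occurs_at f w (length x)" by (simp add: occurs_at_def)
  then show "\<exists>i. occurs_at f w i" ..
next
  assume "\<exists>i. occurs_at f w i"
  then show "sublist f w"
    by (metis occurs_at_def sublist_drop sublist_order.order_trans sublist_take)
qed

lemma occurs_at_appendI: "occurs_at f v i \<Longrightarrow> occurs_at f (x @ v @ y) (length x + i)"
  by (auto simp: occurs_at_iff_nth nth_append)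

lemma occurs_at_inside:
  assumes "occurs_at f (x @ v @ y) i" "length x \<le> i" "i + length f \<le> length x + length v"
  shows "sublist f v"
proof -
  have "occurs_at f v (i - length x)"
    unfolding occurs_at_iff_nth
  proof (intro conjI allI impI)
    show "i - length x + length f \<le> length v" using assms by simp
    fix k assume k: "k < length f"
    then have "(x @ v @ y) ! (i + k) = f ! k" using assms(1) by (simp add: occurs_at_iff_nth)
    with k assms show "v ! (i - length x + k) = f ! k" by (simp add: nth_append split: if_splits)
  qed
  then show ?thesis by (auto simp: sublist_iff_occurs_at)
qed

lemma periodic_nth:
  assumes "\<And>x. x + U < M \<Longrightarrow> w ! x = w ! (x + U)" "x + t * U < M"
  shows "w ! (x + t * U) = w ! x"
  using assms(2)
proof (induction t)
  case (Suc t)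
  then have "w ! (x + t * U) = w ! (x + t * U + U)" by (intro assms(1)) (simp add: algebra_simps)
  with Suc show ?case by (simp add: algebra_simps)
qed simp

lemma occurs_at_periodic:
  assumes "\<And>x. x + U < M \<Longrightarrow> w ! x = w ! (x + U)" "M \<le> length w"
    and "i + t * U + length f \<le> M"
  shows "occurs_at f w (i + t * U) \<longleftrightarrow> occurs_at f w i"
proof -
  have "w ! (i + t * U + k) = w ! (i + k)" if "k < length f" for k
    using periodic_nth[of U M w "i + k" t] assms that by (simp add: algebra_simps)
  with assms show ?thesis by (auto simp: occurs_at_iff_nth)
qed

section \<open>The induction step\<close>

lemma concat_replicate_Suc_right: "concat (replicate (Suc k) w) = concat (replicate k w) @ w"
  by (simp flip: replicate_append_same)

text \<open>With \<open>p = Suc r\<close>, the word consisting of \<open>r\<close> copies of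
  \<open>W\<close> followed by \<open>P\<close> occurs both at position 0, where the last copy of
  \<open>W\<close> supplies \<open>P\<close>, and at \<open>length W\<close>, where \<open>T\<close>
  supplies it.\<close>

lemma nth_power_append_periodic:
  assumes "prefix P W" "prefix P T" "x + length W < p * length W + length P"
  shows "(concat (replicate p W) @ T) ! x = (concat (replicate p W) @ T) ! (x + length W)"
proof (cases p)
  case 0
  with assms show ?thesis by (auto simp: prefix_def)
next
  case (Suc r)
  obtain W' T' where W': "W = P @ W'" and T': "T = P @ T'"
    using assms(1,2) by (auto simp: prefix_def)
  let ?R = "concat (replicate r W)"
  have x: "x < length (?R @ P)"
    using assms(3) Suc by (simp add: length_concat sum_list_replicate)
  have "(concat (replicate p W) @ T) ! x = ((?R @ P) @ W' @ T) ! x"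
    unfolding Suc concat_replicate_Suc_right by (simp add: W')
  also have "\<dots> = ((?R @ P) @ T') ! x" using x by (simp only: nth_append if_True)
  also have "\<dots> = (W @ ?R @ T) ! (x + length W)"
    by (simp add: T' nth_append[of W])
  finally show ?thesis by (simp add: Suc)
qed

text \<open>\<open>ST\<close> and \<open>SP\<close> serve the factors that can escape both positions
  without lying in a single copy of \<open>W\<close>: those behind the second position, and those
  between a translate of the second position and the next translate of the first, modulo
  \<open>length W\<close>.\<close>

lemma is_attractor_power_append:
  fixes p :: nat and W T P S :: "'a list"
  defines "W' \<equiv> concat (replicate p W) @ T"
  assumes "2 \<le> p" "P \<noteq> []" "prefix P W" "prefix P T" "length S < length W" "suffix S W"
    and ST: "sublist (S @ T) W" and SP: "sublist (S @ butlast P) W"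
    and IH: "is_attractor W {length P - 1, length W - length S - 1}"
  shows "is_attractor W' {length W + length P - 1, length W' - length (S @ T) - 1}"
proof -
  define U a b where "U = length W" and "a = length P - 1" and "b = length W - length S - 1"
  have P: "length P = a + 1" using \<open>P \<noteq> []\<close> by (cases P) (auto simp: a_def)
  have b: "b + 1 + length S = U" using \<open>length S < length W\<close> by (simp add: U_def b_def)
  have aU: "a < U" using prefix_length_le[OF \<open>prefix P W\<close>] P by (simp add: U_def)
  have aT: "a < length T" using prefix_length_le[OF \<open>prefix P T\<close>] P by simp
  have lenW': "length W' = p * U + length T"
    by (simp add: W'_def U_def length_concat sum_list_replicate)
  obtain r where r: "p = Suc (Suc r)" using \<open>2 \<le> p\<close> that[of "p - 2"] by simp
  define a' b' where "a' = U + a" and "b' = (p - 1) * U + b"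
  have a'_eq: "length W + length P - 1 = a'" using P by (simp add: a'_def U_def)
  have b'_eq: "length W' - length (S @ T) - 1 = b'"
    using b by (simp add: b'_def lenW' r)
  have IH': "is_attractor W {a, b}" using IH by (simp add: a_def b_def)
  \<comment> \<open>\<open>T\<close> is known to agree with \<open>W\<close> only along
    \<open>P\<close>, so a shift by periods has to end by \<open>p * U + a\<close>.\<close>
  have per: "W' ! x = W' ! (x + U)" if "x + U < p * U + a" for x
    using nth_power_append_periodic[OF \<open>prefix P W\<close> \<open>prefix P T\<close>] that P
    by (simp add: W'_def U_def)
  have shift: "occurs_at f W' (i + t * U) \<longleftrightarrow> occurs_at f W' i"
    if "i + t * U + length f \<le> p * U + a" for i t and f :: "'a list"
    by (rule occurs_at_periodic[OF per]) (use that aT lenW' in auto)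
  have pow: "(p - Suc 0) * U = U + r * U" "p * U = U + U + r * U" by (simp_all add: r)
  let ?hits = "\<lambda>f. \<exists>i. occurs_at f W' i \<and> {i..<i + length f} \<inter> {a', b'} \<noteq> {}"
  have hitI: "?hits f" if "occurs_at f W' i" "i \<le> c" "c < i + length f" "c = a' \<or> c = b'" for f i c
    using that by (intro exI[of _ i]) auto
  have W'_first: "W' = [] @ W @ (concat (replicate (p - 1) W) @ T)"
    by (simp add: W'_def r)
  have W'_second: "W' = W @ W @ (concat (replicate r W) @ T)"
    by (simp add: W'_def r)
  have W'_last: "W' = concat (replicate (p - 1) W) @ W @ T"
    using concat_replicate_Suc_right[of "p - 1" W] by (simp add: W'_def r)
  have len_pow: "length (concat (replicate (p - 1) W)) = (p - 1) * U"
    by (simp add: U_def length_concat sum_list_replicate)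
  have hits_W: "?hits f" if "sublist f W" "f \<noteq> []" for f
  proof -
    have "\<exists>i. occurs_at f W i \<and> {i..<i + length f} \<inter> {a, b} \<noteq> {}"
      using IH' that by (simp add: is_attractor_def)
    then obtain i where i: "occurs_at f W i" "{i..<i + length f} \<inter> {a, b} \<noteq> {}"
      by (elim exE conjE)
    then consider "i \<le> a" "a < i + length f" | "i \<le> b" "b < i + length f" by auto
    then show ?thesis
    proof cases
      case 1
      have "occurs_at f W' (U + i)"
        using occurs_at_appendI[OF i(1), of W "concat (replicate r W) @ T"]
        unfolding U_def W'_second[symmetric] .
      then show ?thesis by (rule hitI[where c = a']) (use 1 in \<open>auto simp: a'_def\<close>)
    next
      case 2
      have "occurs_at f W' ((p - 1) * U + i)"
        using occurs_at_appendI[OF i(1), of "concat (replicate (p - 1) W)" T]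
        unfolding len_pow W'_last[symmetric] .
      then show ?thesis by (rule hitI[where c = b']) (use 2 in \<open>auto simp: b'_def\<close>)
    qed
  qed
  have hits: "?hits f" if f: "f \<noteq> []" "occurs_at f W' i" for f i
  proof -
    let ?j = "i + length f"
    have fit: "?j \<le> p * U + length T" using f(2) lenW' by (simp add: occurs_at_def)
    obtain Z where Z: "W = Z @ S" using \<open>suffix S W\<close> by (auto simp: suffix_def)
    have lenZ: "length Z = b + 1" using b by (simp add: Z U_def)
    have in_W: "?hits f" if "occurs_at f W' i" "i + length f \<le> U" for i
      using occurs_at_inside[of f "[]" W _ i] that f(1) hits_W W'_first by (simp add: U_def)
    consider "p * U + a < ?j" | "?j \<le> p * U + a" "i \<le> a" | "?j \<le> p * U + a" "a < i" by linarith
    then show ?thesis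
    proof cases
      \<comment> \<open>The factor ends beyond the periodic zone: it covers \<open>b'\<close>, or
        starts behind it and lies in the final \<open>S @ T\<close>.\<close>
      case 1
      show ?thesis
      proof (cases "i \<le> b'")
        case True
        then show ?thesis using hitI[OF f(2), of b'] 1 b by (simp add: b'_def pow)
      next
        case False
        have "W' = (concat (replicate (p - 1) W) @ Z) @ (S @ T) @ []"
          by (subst W'_last) (simp add: Z)
        then have "sublist f (S @ T)"
          using occurs_at_inside[of f "concat (replicate (p - 1) W) @ Z" "S @ T" "[]" i] f(2) fit
            False lenZ len_pow b by (simp add: b'_def pow)
        then show ?thesis using hits_W f(1) ST sublist_order.order_trans by blast
      qed
    next
      case 2
      \<comment> \<open>Either the factor lies in the first copy of \<open>W\<close>, or shifting it
        by \<open>U\<close> carries its position \<open>a\<close> to \<open>a'\<close>, or there is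
        no room for that shift; then it already reaches beyond \<open>a'\<close>, since
        \<open>p\<close> is at least 2.\<close>
      note start = \<open>i \<le> a\<close>
      consider "?j \<le> a" | "a < ?j" "?j + U \<le> p * U + a" | "p * U + a < ?j + U" by linarith
      then show ?thesis
      proof cases
        case 1
        then show ?thesis using in_W[OF f(2)] aU by simp
      next
        case 2
        then have "occurs_at f W' (i + U)" using shift[of i 1 f] f(2) by simp
        then show ?thesis by (rule hitI[where c = a']) (use 2 start in \<open>auto simp: a'_def\<close>)
      next
        case 3
        then show ?thesis using hitI[OF f(2), of a'] start by (simp add: a'_def pow)
      qed
    next
      case 3
      \<comment> \<open>\<open>i'\<close> represents \<open>i\<close> modulo \<open>U\<close> in the
        window from \<open>a + 1\<close> to \<open>a + U = a'\<close>, so an occurrence at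
        \<open>i'\<close> that misses \<open>a'\<close> ends before it.\<close>
      define t i' where "t = (i - (a + 1)) div U" and "i' = a + 1 + (i - (a + 1)) mod U"
      have i: "i = i' + t * U" using 3 by (simp add: t_def i'_def)
      have "(i - (a + 1)) mod U < U" using aU by simp
      then have i': "a < i'" "i' \<le> U + a" by (simp_all add: i'_def)
      have occ: "occurs_at f W' i'" using shift[of i' t f] 3 f(2) by (simp add: i)
      consider "a' < i' + length f" | "i' + length f \<le> a'" "i' \<le> b" "b < i' + length f"
        | "i' + length f \<le> b" | "i' + length f \<le> a'" "b < i'" by linarith
      then show ?thesis
      proof cases
        case 1
        then show ?thesis using hitI[OF occ, of a'] i' by (simp add: a'_def)
      next
        case 2
        \<comment> \<open>Ending by \<open>a' = U + a\<close> leaves room for \<open>p - 1\<close>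
          further periods, which carry \<open>b\<close> to \<open>b'\<close>.\<close>
        have "occurs_at f W' (i' + (p - 1) * U)"
          using shift[of i' "p - 1" f] occ 2 by (simp add: a'_def pow)
        then show ?thesis by (rule hitI[where c = b']) (use 2 in \<open>auto simp: b'_def\<close>)
      next
        case 3
        then show ?thesis using in_W[OF occ] b by simp
      next
        case 4
        \<comment> \<open>Strictly between \<open>b\<close> and \<open>a'\<close> lie the end
          \<open>S\<close> of the first copy of \<open>W\<close> and the first \<open>a\<close>
          letters of the second, which form \<open>butlast P\<close>.\<close>
        obtain V where V: "W = butlast P @ V"
          using \<open>prefix P W\<close> \<open>P \<noteq> []\<close> by (metis append_butlast_last_id append.assoc prefix_def)
        have "W' = Z @ (S @ butlast P) @ (V @ concat (replicate r W) @ T)"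
          by (subst W'_second, subst (2) V) (simp add: Z)
        then have "sublist f (S @ butlast P)"
          using occurs_at_inside[of f Z "S @ butlast P" _ i'] occ 4 lenZ b P by (simp add: a'_def)
        then show ?thesis using hits_W f(1) SP sublist_order.order_trans by blast
      qed
    qed
  qed
  have "a' < length W'" "b' < length W'" using aU b lenW' by (auto simp: a'_def b'_def pow)
  then show ?thesis
    unfolding a'_eq b'_eq is_attractor_def using hits by (auto simp: sublist_iff_occurs_at)
qed

section \<open>The words \<open>\<phi>\<^sup>n(0)\<close> and \<open>\<phi>\<^sup>n(1)\<close>\<close>

context
  fixes p q :: nat
begin

abbreviation W :: "nat \<Rightarrow> bit list" where "W n \<equiv> (\<phi> p q ^^ n) [0]"
abbreviation T :: "nat \<Rightarrow> bit list" where "T n \<equiv> (\<phi> p q ^^ n) [1]"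

text \<open>The first position of \<open>\<Gamma>\<^sub>n\<close> is the last one of the prefix \<open>P n\<close> of \<open>W n\<close>; the suffix \<open>S n\<close> starts
  right behind the second one.\<close>

definition P :: "nat \<Rightarrow> bit list" where "P n = concat (map W (rev [0..<n]))"
definition S :: "nat \<Rightarrow> bit list" where "S n = concat (map T [1..<n])"

lemma \<phi>_pow_replicate: "(\<phi> p q ^^ n) (replicate k a) = concat (replicate k ((\<phi> p q ^^ n) [a]))"
proof (induction k)
  case 0
  show ?case by (induction n) (simp_all add: \<phi>_def)
next
  case (Suc k)
  then show ?case using \<phi>_pow_append[of n p q "[a]" "replicate k a"] by simp
qed

lemma W_Suc: "W (Suc n) = concat (replicate p (W n)) @ T n"
proof -
  have "W (Suc n) = (\<phi> p q ^^ n) (replicate p 0 @ [1])"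
    by (simp add: funpow_Suc_right \<phi>_def \<phi>_letter_def del: funpow.simps)
  then show ?thesis by (simp add: \<phi>_pow_append \<phi>_pow_replicate)
qed

lemma T_Suc: "T (Suc n) = concat (replicate q (W n)) @ T n"
proof -
  have "T (Suc n) = (\<phi> p q ^^ n) (replicate q 0 @ [1])"
    by (simp add: funpow_Suc_right \<phi>_def \<phi>_letter_def del: funpow.simps)
  then show ?thesis by (simp add: \<phi>_pow_append \<phi>_pow_replicate)
qed

lemma P_0: "P 0 = []" and P_Suc: "P (Suc n) = W n @ P n"
  by (simp_all add: P_def)

lemma S_1: "S (Suc 0) = []" and S_Suc: "1 \<le> n \<Longrightarrow> S (Suc n) = S n @ T n"
  by (simp_all add: S_def)

lemma length_P: "length (P n) = (\<Sum>j\<in>{0..<n}. length (W j))"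
  by (induction n) (simp_all add: P_0 P_Suc)

lemma length_S: "length (S n) = (\<Sum>j\<in>{1..<n}. length (T j))"
  by (simp add: S_def length_concat comp_def interv_sum_list_conv_sum_set_nat)

lemma \<Gamma>\<^sub>n_eq: "\<Gamma>\<^sub>n p q n = {length (P n) - 1, length (W n) - length (S n) - 1}"
  by (simp add: \<Gamma>\<^sub>n_def length_P length_S)

section \<open>Common prefixes and suffixes of the iterated images\<close>

lemma prefix_P_power:
  assumes "prefix (P n) (W n)" "prefix (P n) (T n)" "1 \<le> k"
  shows "prefix (P (Suc n)) (concat (replicate k (W n)) @ T n)"
proof -
  obtain k' where k: "k = Suc k'" using \<open>1 \<le> k\<close> by (cases k) auto
  \<comment> \<open>After the first \<open>W n\<close>, the required \<open>P n\<close> begins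
    \<open>T n\<close> if \<open>k = 1\<close>, and the next copy of \<open>W n\<close>
    otherwise.\<close>
  show ?thesis
    using assms by (cases k') (auto simp: k P_Suc prefix_append)
qed

lemma prefix_P:
  assumes "1 \<le> p" "1 \<le> q"
  shows "prefix (P n) (W n) \<and> prefix (P n) (T n)"
proof (induction n)
  case 0
  then show ?case by (simp add: P_0)
next
  case (Suc n)
  then show ?case unfolding W_Suc T_Suc using assms by (blast intro: prefix_P_power)
qed

text \<open>The last \<open>q\<close> of the \<open>p\<close> copies of \<open>W n\<close> form
  \<open>T (Suc n)\<close> together with \<open>T n\<close>; as \<open>q < p\<close>, at least one
  copy precedes them.\<close>

lemma W_Suc_eq_T_Suc:
  assumes "q < p"
  shows "W (Suc n) = concat (replicate (p - q - 1) (W n)) @ W n @ T (Suc n)"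
proof -
  have "p = Suc (p - q - 1) + q" using assms by simp
  then have "concat (replicate p (W n)) =
      concat (replicate (Suc (p - q - 1)) (W n)) @ concat (replicate q (W n))"
    by (metis concat_append replicate_add)
  then show ?thesis
    unfolding W_Suc T_Suc concat_replicate_Suc_right by simp
qed

text \<open>\<open>T (Suc n)\<close> ends \<open>W (Suc n)\<close> right after a copy of
  \<open>W n\<close>, which inductively ends in \<open>S (Suc n)\<close>. The index runs one ahead
  so that \<open>S n @ T n\<close> is a factor of \<open>W n\<close> for n \<ge> 1.\<close>

lemma suffix_S_Suc:
  assumes "q < p"
  shows "suffix (S (Suc n)) (W n)"
proof (induction n)
  case 0
  then show ?case by (simp add: S_1)
next
  case (Suc n)
  then obtain Z where "W n = Z @ S (Suc n)" by (auto simp: suffix_def)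
  then have "W (Suc n) = (concat (replicate (p - q - 1) (W n)) @ Z) @ S (Suc (Suc n))"
    using W_Suc_eq_T_Suc[OF assms, of n] by (simp add: S_Suc del: funpow.simps)
  then show ?case by (rule suffixI)
qed

lemma suffix_S:
  assumes "1 \<le> p" "1 \<le> n"
  shows "suffix (S n) (W n)"
  using assms(2)
proof (induction n rule: dec_induct)
  case base
  then show ?case by (simp add: S_1)
next
  case (step n)
  then obtain Z where "W n = Z @ S n" by (auto simp: suffix_def)
  moreover have "concat (replicate p (W n)) = concat (replicate (p - 1) (W n)) @ W n"
    using concat_replicate_Suc_right[of "p - 1" "W n"] assms(1) by (simp del: replicate_Suc)
  ultimately have "W (Suc n) = (concat (replicate (p - 1) (W n)) @ Z) @ S (Suc n)"
    using step(1) by (simp add: W_Suc S_Suc del: funpow.simps)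
  then show ?case by (rule suffixI)
qed

text \<open>For \<open>n = Suc m\<close>, the word \<open>W n\<close> ends in
  \<open>W m @ W m @ T m\<close>, since \<open>p\<close> is at least 2. The first copy ends in
  \<open>S n\<close>; the second, continued by the prefix \<open>P m\<close> of \<open>T m\<close>,
  is \<open>P n\<close>.\<close>

lemma sublist_S_butlast_P:
  assumes "q < p" "1 \<le> q" "1 \<le> n"
  shows "sublist (S n @ butlast (P n)) (W n)"
proof -
  obtain m where m: "n = Suc m" using \<open>1 \<le> n\<close> by (cases n) auto
  show ?thesis
  proof (cases m)
    case 0
    then show ?thesis by (simp add: m S_1 P_Suc P_0)
  next
    case (Suc l)
    obtain Z where Z: "W m = Z @ S (Suc m)"
      using suffix_S_Suc[OF assms(1), of m] by (auto simp: suffix_def)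
    \<comment> \<open>With \<open>P m\<close> non-empty, \<open>butlast\<close> of
      \<open>W m @ P m\<close> removes a letter of \<open>P m\<close>, not of
      \<open>W m\<close>.\<close>
    have "W l \<noteq> []" using length_\<phi>_pow_0[of p l q] assms(1) by auto
    then have ne: "P m \<noteq> []" by (simp add: Suc P_Suc)
    obtain Y where Y: "T m = butlast (P m) @ Y"
      using prefix_P[of m] assms ne
      by (metis append_butlast_last_id append.assoc prefix_def le_trans less_imp_le)
    have "p - 2 + 2 = p" using assms by simp
    then have "replicate p (W m) = replicate (p - 2) (W m) @ replicate 2 (W m)"
      by (simp only: flip: replicate_add)
    then have "concat (replicate p (W m)) = concat (replicate (p - 2) (W m)) @ W m @ W m"
      by (simp add: numeral_2_eq_2)
    also have "\<dots> = concat (replicate (p - 2) (W m)) @ (Z @ S (Suc m)) @ W m"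
      using Z by (simp only:)
    finally have "W n =
        (concat (replicate (p - 2) (W m)) @ Z) @ (S (Suc m) @ butlast (P (Suc m))) @ Y"
      using Y ne by (simp add: m W_Suc P_Suc butlast_append del: funpow.simps)
    then show ?thesis unfolding m sublist_def by blast
  qed
qed

section \<open>The attractors of the prefixes, by induction\<close>

lemma is_attractor_W_1: "is_attractor (W (Suc 0)) (\<Gamma>\<^sub>n p q (Suc 0))"
proof -
  have W1: "W (Suc 0) = replicate p 0 @ [1]" by (simp add: \<phi>_def \<phi>_letter_def)
  have \<Gamma>1: "\<Gamma>\<^sub>n p q (Suc 0) = {0, p}" by (simp add: \<Gamma>\<^sub>n_def \<phi>_def \<phi>_letter_def)
  \<comment> \<open>A block of zeros also occurs at position 0; every other factor ends with the
    final 1, at position \<open>p\<close>.\<close>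
  have "\<exists>i. occurs_at f (replicate p 0 @ [1]) i \<and> {i..<i + length f} \<inter> {0, p} \<noteq> {}"
    if f: "f \<noteq> []" "occurs_at f (replicate p 0 @ [1]) i" for f :: "bit list" and i
  proof (cases "i + length f \<le> p")
    case True
    then have "occurs_at f (replicate p 0 @ [1]) 0"
      using f(2) by (auto simp: occurs_at_iff_nth nth_append)
    then show ?thesis using f(1) by (intro exI[of _ 0]) auto
  next
    case False
    then show ?thesis using f by (intro exI[of _ i]) (auto simp: occurs_at_def)
  qed
  then show ?thesis unfolding W1 \<Gamma>1 is_attractor_def by (auto simp: sublist_iff_occurs_at)
qed

lemma is_attractor_W:
  assumes "q < p" "1 \<le> q" "1 \<le> n"
  shows "is_attractor (W n) (\<Gamma>\<^sub>n p q n)"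
  using assms(3)
proof (induction n rule: dec_induct)
  case base
  show ?case using is_attractor_W_1 by simp
next
  case (step n)
  have "P n \<noteq> []"
    using \<Gamma>\<^sub>n_no_truncation(1)[of p n q] assms(1) step(1) by (auto simp flip: length_P)
  moreover have "length (S n) < length (W n)"
    using \<Gamma>\<^sub>n_no_truncation(2)[of p n q] assms(1) step(1) by (simp add: length_S)
  moreover have "sublist (S n @ T n) (W n)"
    using suffix_S_Suc[OF assms(1), of n] step(1) by (simp add: S_Suc suffix_imp_sublist)
  ultimately have "is_attractor (concat (replicate p (W n)) @ T n)
      {length (W n) + length (P n) - 1,
       length (concat (replicate p (W n)) @ T n) - length (S n @ T n) - 1}"
    using assms step prefix_P[of n] suffix_S[of n] sublist_S_butlast_P[of n]
    by (intro is_attractor_power_append) (auto simp: \<Gamma>\<^sub>n_eq)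
  then show ?case
    using step(1) by (simp only: \<Gamma>\<^sub>n_eq P_Suc S_Suc length_append flip: W_Suc)
qed

lemma fixed_point_W:
  assumes "\<phi>_inf p q u = u" "shd u = 0"
  shows "\<exists>s. u = W n @- s"
proof (induction n)
  case 0
  then show ?case using assms(2) by (cases u) auto
next
  case (Suc n)
  then obtain s where "u = W n @- s" by blast
  then have "\<phi>_inf p q u = W (Suc n) @- \<phi>_inf p q s" by (simp add: \<phi>_inf_shift)
  then show ?case using assms(1) by metis
qed

end

theorem theorem5p6:
  fixes p q n :: nat and u :: "bit stream"
  assumes "p > q" and "q \<ge> 1"
    and "\<phi>_inf p q u = u" and "shd u = 0"
    and "n \<ge> 1"
  shows "stake (length ((\<phi> p q ^^ n) [0])) u = (\<phi> p q ^^ n) [0] \<and>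
         is_attractor ((\<phi> p q ^^ n) [0]) (\<Gamma>\<^sub>n p q n)"
proof
  obtain s where "u = (\<phi> p q ^^ n) [0] @- s" using fixed_point_W assms(3,4) by blast
  then show "stake (length ((\<phi> p q ^^ n) [0])) u = (\<phi> p q ^^ n) [0]" by (simp add: stake_shift)
  show "is_attractor ((\<phi> p q ^^ n) [0]) (\<Gamma>\<^sub>n p q n)" using assms by (intro is_attractor_W) auto
qed

end
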